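(* Let $l$ be a positive integer, let $D_l$ be the dihedral group of order $2l$, let $\alpha \in \mathrm{Aut}(D_l)$, and let $S_{\alpha} = \{g \in D_l \mid \alpha(g) = g^{-1}\}$. Then $T(D_l) \geq |S_{\alpha}|$.
   Context: $D_l = \langle r, s \mid r^l = s^2 = 1,\ srs^{-1} = r^{-1}\rangle$ is the dihedral group of order $2l$, whose elements are uniquely $r^k$ or $r^k s$ with $0 \le k < l$. For a finite group $G$, $\mathrm{Aut}(G)$ denotes its automorphism group and $T(G)$ denotes the sum of the degrees of the irreducible complex representations of $G$ (one from each isomorphism class). *)

theory Defs
  imports
    "HOL-Algebra.Bij"
    "Jordan_Normal_Form.VS_Connect"
begin

section \<open>The dihedral group of order 2l\<close>

text \<open>
  The pair \<open>(k, b)\<close> stands for \<open>r\<^sup>k\<close> if \<open>b\<close> is false and for \<open>r\<^sup>k s\<close> if \<open>b\<close> is true.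
  From \<open>s r s\<^sup>-\<^sup>1 = r\<^sup>-\<^sup>1\<close> one gets \<open>(r\<^sup>i s) (r\<^sup>j s\<^sup>c) = r\<^bsup>i - j\<^esup> s\<^bsup>1 + c\<^esup>\<close>.
\<close>

definition dihedral_group :: "nat \<Rightarrow> (int \<times> bool) monoid" where
  "dihedral_group l =
    \<lparr>carrier = {0..<int l} \<times> UNIV,
     mult = (\<lambda>(i, b) (j, c). ((if b then i - j else i + j) mod int l, b \<noteq> c)),
     one = (0, False)\<rparr>"

text \<open>The residue is needed for \<open>l = 1\<close>, where \<open>r\<close> is trivial.\<close>

definition dihedral_r :: "nat \<Rightarrow> int \<times> bool" where
  "dihedral_r l = (1 mod int l, False)"

definition dihedral_s :: "int \<times> bool" where
  "dihedral_s = (0, True)"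

lemma group_dihedral_group:
  assumes "l > 0"
  shows "group (dihedral_group l)"
proof (rule groupI)
  let ?D = "dihedral_group l"
  fix x y z
  assume "x \<in> carrier ?D" "y \<in> carrier ?D" "z \<in> carrier ?D"
  obtain i b j c k d where "x = (i, b)" "y = (j, c)" "z = (k, d)"
    by (metis surj_pair)
  then show "x \<otimes>\<^bsub>?D\<^esub> y \<otimes>\<^bsub>?D\<^esub> z = x \<otimes>\<^bsub>?D\<^esub> (y \<otimes>\<^bsub>?D\<^esub> z)"
    by (auto simp: dihedral_group_def mod_simps algebra_simps)
next
  let ?D = "dihedral_group l"
  fix x
  assume x: "x \<in> carrier ?D"
  obtain i b where ib: "x = (i, b)"
    by (metis surj_pair)
  show "\<exists>y\<in>carrier ?D. y \<otimes>\<^bsub>?D\<^esub> x = \<one>\<^bsub>?D\<^esub>"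
  proof (rule bexI)
    show "(if b then (i, True) else ((- i) mod int l, False)) \<otimes>\<^bsub>?D\<^esub> x = \<one>\<^bsub>?D\<^esub>"
      using ib by (auto simp: dihedral_group_def mod_simps)
    show "(if b then (i, True) else ((- i) mod int l, False)) \<in> carrier ?D"
      using ib x assms by (auto simp: dihedral_group_def)
  qed
qed (use assms in \<open>auto simp: dihedral_group_def\<close>)

lemma order_dihedral_group: "Coset.order (dihedral_group l) = 2 * l"
  by (simp add: Coset.order_def dihedral_group_def card_cartesian_product)

lemma dihedral_r_pow:
  "dihedral_r l [^]\<^bsub>dihedral_group l\<^esub> (k::nat) = (int k mod int l, False)"
proof (induction k)
  case 0
  then show ?case by (simp add: dihedral_group_def)
next
  case (Suc k)
  then show ?case
    by (auto simp: nat_pow_Suc dihedral_group_def dihedral_r_def mod_simps algebra_simps)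
qed

lemma dihedral_generators_in_carrier:
  assumes "l > 0"
  shows "dihedral_r l \<in> carrier (dihedral_group l)" "dihedral_s \<in> carrier (dihedral_group l)"
  using assms by (auto simp: dihedral_group_def dihedral_r_def dihedral_s_def)

lemma dihedral_relations:
  fixes l :: nat
  defines "D \<equiv> dihedral_group l"
  assumes "l > 0"
  shows "dihedral_r l [^]\<^bsub>D\<^esub> l = \<one>\<^bsub>D\<^esub>"
    and "dihedral_s [^]\<^bsub>D\<^esub> (2::nat) = \<one>\<^bsub>D\<^esub>"
    and "dihedral_s \<otimes>\<^bsub>D\<^esub> dihedral_r l \<otimes>\<^bsub>D\<^esub> inv\<^bsub>D\<^esub> dihedral_s = inv\<^bsub>D\<^esub> dihedral_r l"
proof -
  interpret group D
    unfolding D_def by (rule group_dihedral_group[OF assms(2)])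
  have rs: "dihedral_r l \<in> carrier D" "dihedral_s \<in> carrier D"
    unfolding D_def using dihedral_generators_in_carrier[OF assms(2)] by auto
  show "dihedral_r l [^]\<^bsub>D\<^esub> l = \<one>\<^bsub>D\<^esub>"
    unfolding D_def dihedral_r_pow by (simp add: dihedral_group_def)
  have ss: "dihedral_s \<otimes>\<^bsub>D\<^esub> dihedral_s = \<one>\<^bsub>D\<^esub>"
    by (simp add: D_def dihedral_group_def dihedral_s_def)
  then show "dihedral_s [^]\<^bsub>D\<^esub> (2::nat) = \<one>\<^bsub>D\<^esub>"
    using rs by (simp add: numeral_2_eq_2)
  have inv_s: "inv\<^bsub>D\<^esub> dihedral_s = dihedral_s"
    using ss rs by (simp add: inv_equality)
  have "dihedral_s \<otimes>\<^bsub>D\<^esub> dihedral_r l \<otimes>\<^bsub>D\<^esub> dihedral_s \<otimes>\<^bsub>D\<^esub> dihedral_r l = \<one>\<^bsub>D\<^esub>"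
    by (simp add: D_def dihedral_group_def dihedral_s_def dihedral_r_def mod_simps)
  then have "inv\<^bsub>D\<^esub> dihedral_r l = dihedral_s \<otimes>\<^bsub>D\<^esub> dihedral_r l \<otimes>\<^bsub>D\<^esub> dihedral_s"
    using rs by (simp add: inv_equality)
  then show "dihedral_s \<otimes>\<^bsub>D\<^esub> dihedral_r l \<otimes>\<^bsub>D\<^esub> inv\<^bsub>D\<^esub> dihedral_s = inv\<^bsub>D\<^esub> dihedral_r l"
    using inv_s by simp
qed

lemma carrier_dihedral_group:
  fixes l :: nat
  defines "D \<equiv> dihedral_group l"
  shows "carrier D = {dihedral_r l [^]\<^bsub>D\<^esub> k | k::nat. k < l} \<union>
                     {dihedral_r l [^]\<^bsub>D\<^esub> k \<otimes>\<^bsub>D\<^esub> dihedral_s | k::nat. k < l}"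
    (is "_ = ?A \<union> ?B")
proof -
  have "\<And>k. k < l \<Longrightarrow> dihedral_r l [^]\<^bsub>D\<^esub> k = (int k, False)"
    unfolding D_def dihedral_r_pow by simp
  then have A: "?A = (\<lambda>k. (int k, False)) ` {..<l}"
    by force
  have "\<And>k. k < l \<Longrightarrow> dihedral_r l [^]\<^bsub>D\<^esub> k \<otimes>\<^bsub>D\<^esub> dihedral_s = (int k, True)"
    unfolding D_def dihedral_r_pow by (simp add: dihedral_group_def dihedral_s_def)
  then have B: "?B = (\<lambda>k. (int k, True)) ` {..<l}"
    by force
  have "{0..<int l} = int ` {..<l}"
    by (simp add: image_int_atLeastLessThan lessThan_atLeast0)
  then have "carrier D = int ` {..<l} \<times> UNIV"
    by (simp add: D_def dihedral_group_def)
  also have "\<dots> = ?A \<union> ?B"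
    unfolding A B UNIV_bool by auto
  finally show ?thesis .
qed


section \<open>Complex representations and the sum of the irreducible degrees\<close>

definition GL_complex :: "nat \<Rightarrow> complex mat monoid" where
  "GL_complex n = units_of (ring_mat TYPE(complex) n ())"

text \<open>
  Up to isomorphism, a finite-dimensional complex representation of \<open>G\<close> is a pair of a
  degree \<open>n\<close> and a homomorphism from \<open>G\<close> to the automorphism group of the space of column
  vectors of length \<open>n\<close>.
\<close>

type_synonym 'a rep = "nat \<times> ('a \<Rightarrow> complex mat)"

definition is_rep :: "('a, 'b) monoid_scheme \<Rightarrow> 'a rep \<Rightarrow> bool" where
  "is_rep G = (\<lambda>(n, \<rho>). \<rho> \<in> hom G (GL_complex n))"

definition invariant_subspace :: "('a, 'b) monoid_scheme \<Rightarrow> 'a rep \<Rightarrow> complex vec set \<Rightarrow> bool" where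
  "invariant_subspace G = (\<lambda>(n, \<rho>) W.
     subspace class_ring W (module_vec TYPE(complex) n) \<and>
     (\<forall>g\<in>carrier G. \<forall>w\<in>W. \<rho> g *\<^sub>v w \<in> W))"

definition irreducible_rep :: "('a, 'b) monoid_scheme \<Rightarrow> 'a rep \<Rightarrow> bool" where
  "irreducible_rep G = (\<lambda>(n, \<rho>).
     is_rep G (n, \<rho>) \<and> n > 0 \<and>
     (\<forall>W. invariant_subspace G (n, \<rho>) W \<longrightarrow> W = {0\<^sub>v n} \<or> W = carrier_vec n))"

text \<open>
  An isomorphism of representations is an invertible intertwining matrix. Only the values on
  the carrier matter, so homomorphisms differing outside it are identified as well.
\<close>

definition rep_iso :: "('a, 'b) monoid_scheme \<Rightarrow> 'a rep \<Rightarrow> 'a rep \<Rightarrow> bool" where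
  "rep_iso G = (\<lambda>(m, \<rho>) (n, \<sigma>).
     m = n \<and> (\<exists>P\<in>carrier (GL_complex n). \<forall>g\<in>carrier G. P * \<rho> g = \<sigma> g * P))"

definition irreducible_classes :: "('a, 'b) monoid_scheme \<Rightarrow> 'a rep set set" where
  "irreducible_classes G =
     {\<rho>. irreducible_rep G \<rho>} //
     {(\<rho>, \<sigma>). irreducible_rep G \<rho> \<and> irreducible_rep G \<sigma> \<and> rep_iso G \<rho> \<sigma>}"

text \<open>
  Isomorphic representations have the same degree, so the choice of the representative does
  not matter. A finite group has only finitely many classes; the sum would be 0 if there were
  infinitely many.
\<close>

definition sum_irreducible_degrees :: "('a, 'b) monoid_scheme \<Rightarrow> nat" where
  "sum_irreducible_degrees G = (\<Sum>C\<in>irreducible_classes G. fst (SOME \<rho>. \<rho> \<in> C))"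

lemma carrier_GL_complex:
  "carrier (GL_complex n) =
     {A \<in> carrier_mat n n. \<exists>B\<in>carrier_mat n n. B * A = 1\<^sub>m n \<and> A * B = 1\<^sub>m n}"
  by (auto simp: GL_complex_def units_of_def Units_def ring_mat_def)

lemma group_GL_complex: "group (GL_complex n)"
proof -
  interpret ring "ring_mat TYPE(complex) n ()"
    by (rule ring_mat)
  show ?thesis
    unfolding GL_complex_def by (rule units_group)
qed

lemma equiv_rep_iso:
  "equiv {\<rho>. irreducible_rep G \<rho>}
     {(\<rho>, \<sigma>). irreducible_rep G \<rho> \<and> irreducible_rep G \<sigma> \<and> rep_iso G \<rho> \<sigma>}"
proof -
  have rep_mat: "\<rho> g \<in> carrier_mat n n"
    if "irreducible_rep G (n, \<rho>)" "g \<in> carrier G" for n \<rho> g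
    using that by (auto simp: irreducible_rep_def is_rep_def hom_def carrier_GL_complex Pi_def)
  have refl: "rep_iso G (n, \<rho>) (n, \<rho>)" if "irreducible_rep G (n, \<rho>)" for n \<rho>
  proof -
    have "1\<^sub>m n \<in> carrier (GL_complex n)"
      by (auto simp: carrier_GL_complex)
    moreover have "1\<^sub>m n * \<rho> g = \<rho> g * 1\<^sub>m n" if "g \<in> carrier G" for g
      using rep_mat[OF \<open>irreducible_rep G (n, \<rho>)\<close> that]
      by (simp add: left_mult_one_mat[of _ n n] right_mult_one_mat[of _ n n])
    ultimately show ?thesis
      by (auto simp: rep_iso_def)
  qed
  have sym: "rep_iso G (n, \<sigma>) (m, \<rho>)"
    if irr: "irreducible_rep G (m, \<rho>)" "irreducible_rep G (n, \<sigma>)"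
      and iso: "rep_iso G (m, \<rho>) (n, \<sigma>)" for m n \<rho> \<sigma>
  proof -
    from iso obtain P where P: "m = n" "P \<in> carrier (GL_complex n)"
      "\<And>g. g \<in> carrier G \<Longrightarrow> P * \<rho> g = \<sigma> g * P"
      by (auto simp: rep_iso_def)
    then obtain Q where Q: "P \<in> carrier_mat n n" "Q \<in> carrier_mat n n"
      "Q * P = 1\<^sub>m n" "P * Q = 1\<^sub>m n"
      by (auto simp: carrier_GL_complex)
    have "Q * \<sigma> g = \<rho> g * Q" if g: "g \<in> carrier G" for g
    proof -
      have [simp]: "\<rho> g \<in> carrier_mat n n" "\<sigma> g \<in> carrier_mat n n"
        using rep_mat irr P(1) g by auto
      note mat = assoc_mult_mat[of _ n n _ n _ n] mult_carrier_mat[of _ n n _ n]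
        left_mult_one_mat[of _ n n] right_mult_one_mat[of _ n n]
      have "Q * \<sigma> g = Q * (\<sigma> g * (P * Q))"
        by (simp add: Q(4) mat)
      also have "\<dots> = Q * ((\<sigma> g * P) * Q)"
        by (simp add: Q(1,2) mat)
      also have "\<dots> = Q * ((P * \<rho> g) * Q)"
        by (simp add: P(3)[OF g])
      also have "\<dots> = (Q * P) * (\<rho> g * Q)"
        by (simp add: Q(1,2) mat)
      also have "\<dots> = \<rho> g * Q"
        by (simp add: Q(2,3) mat)
      finally show ?thesis .
    qed
    moreover have "Q \<in> carrier (GL_complex m)"
      using Q P(1) by (auto simp: carrier_GL_complex)
    ultimately show ?thesis
      using P(1) by (auto simp: rep_iso_def)
  qed
  have trans: "rep_iso G (m, \<rho>) (k, \<tau>)"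
    if irr: "irreducible_rep G (m, \<rho>)" "irreducible_rep G (n, \<sigma>)" "irreducible_rep G (k, \<tau>)"
      and iso: "rep_iso G (m, \<rho>) (n, \<sigma>)" "rep_iso G (n, \<sigma>) (k, \<tau>)" for m n k \<rho> \<sigma> \<tau>
  proof -
    from iso obtain P Q where P: "m = n" "P \<in> carrier (GL_complex n)"
      "\<And>g. g \<in> carrier G \<Longrightarrow> P * \<rho> g = \<sigma> g * P"
      and Q: "n = k" "Q \<in> carrier (GL_complex n)"
      "\<And>g. g \<in> carrier G \<Longrightarrow> Q * \<sigma> g = \<tau> g * Q"
      by (auto simp: rep_iso_def)
    have [simp]: "P \<in> carrier_mat n n" "Q \<in> carrier_mat n n"
      using P(2) Q(2) by (auto simp: carrier_GL_complex)
    have "(Q * P) * \<rho> g = \<tau> g * (Q * P)" if g: "g \<in> carrier G" for g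
    proof -
      have [simp]: "\<rho> g \<in> carrier_mat n n" "\<sigma> g \<in> carrier_mat n n" "\<tau> g \<in> carrier_mat n n"
        using rep_mat irr P(1) Q(1) g by auto
      note mat = assoc_mult_mat[of _ n n _ n _ n] mult_carrier_mat[of _ n n _ n]
      have "(Q * P) * \<rho> g = Q * (P * \<rho> g)"
        by (simp add: mat)
      also have "\<dots> = Q * (\<sigma> g * P)"
        by (simp add: P(3)[OF g])
      also have "\<dots> = (Q * \<sigma> g) * P"
        by (simp add: mat)
      also have "\<dots> = (\<tau> g * Q) * P"
        by (simp add: Q(3)[OF g])
      also have "\<dots> = \<tau> g * (Q * P)"
        by (simp add: mat)
      finally show ?thesis .
    qed
    moreover have "Q * P \<in> carrier (GL_complex n)"
    proof -
      have "Q \<otimes>\<^bsub>GL_complex n\<^esub> P \<in> carrier (GL_complex n)"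
        using group_GL_complex[of n] P(2) Q(2) by (simp add: group.is_monoid monoid.m_closed)
      then show ?thesis
        by (simp add: GL_complex_def units_of_def ring_mat_def)
    qed
    ultimately show ?thesis
      using P(1) Q(1) by (auto simp: rep_iso_def)
  qed
  show ?thesis
  proof (rule equivI)
    show "{(\<rho>, \<sigma>). irreducible_rep G \<rho> \<and> irreducible_rep G \<sigma> \<and> rep_iso G \<rho> \<sigma>}
            \<subseteq> {\<rho>. irreducible_rep G \<rho>} \<times> {\<rho>. irreducible_rep G \<rho>}"
      by auto
  next
    show "refl_on {\<rho>. irreducible_rep G \<rho>}
            {(\<rho>, \<sigma>). irreducible_rep G \<rho> \<and> irreducible_rep G \<sigma> \<and> rep_iso G \<rho> \<sigma>}"
      using refl by (auto simp: refl_on_def)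
  next
    show "sym {(\<rho>, \<sigma>). irreducible_rep G \<rho> \<and> irreducible_rep G \<sigma> \<and> rep_iso G \<rho> \<sigma>}"
      using sym by (auto intro!: symI)
  next
    show "trans {(\<rho>, \<sigma>). irreducible_rep G \<rho> \<and> irreducible_rep G \<sigma> \<and> rep_iso G \<rho> \<sigma>}"
      unfolding trans_def using trans by (simp only: mem_Collect_eq case_prod_conv split_paired_All) meson
  qed
qed

end

theory Submission
  imports Defs "Jordan_Normal_Form.Spectral_Radius"
begin

text \<open>
  Both sides are compared with \<open>l + gcd 2 l\<close>, which is the group order if \<open>l = 2\<close>. Otherwise an automorphism sends \<open>r\<close> to some
  \<open>r\<^sup>a\<close>, so the rotations \<open>r\<^sup>i\<close> it inverts satisfy \<open>(a + 1) i \<equiv> 0\<close> modulo \<open>l\<close> and the inverted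
  reflections \<open>r\<^sup>i s\<close> satisfy \<open>(a - 1) i + c \<equiv> 0\<close>. These congruences have at most
  \<open>gcd (a + 1) l\<close> and \<open>gcd (a - 1) l\<close> solutions. Both numbers are at most \<open>l / 2\<close> unless \<open>l\<close>
  divides \<open>a + 1\<close> or \<open>a - 1\<close>, and in that case one of them is at most \<open>gcd 2 l\<close>.

  On the representation side, for every \<open>l\<close>-th root of unity \<open>z\<close> in the upper half plane there is an
  irreducible plane on which \<open>r\<close> acts as \<open>diag(z, z\<^sup>-\<^sup>1)\<close>, and every real root \<open>z = \<plusminus>1\<close> gives two
  characters. A plane accounts for \<open>z\<close> and its conjugate, so each of the \<open>l\<close> roots contributes one to the sum of the degrees, and each of the
  \<open>gcd 2 l\<close> real ones a further one. An eigenvector \<open>v\<close> of \<open>r\<close> spans together with \<open>s v\<close> an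
  invariant subspace, hence there are only finitely many irreducible representations.
\<close>

section \<open>Counting elements inverted by an automorphism\<close>

text \<open>With \<open>g = gcd m l\<close> and \<open>q = l / g\<close>, two solutions differ by a
  multiple of \<open>q\<close>, because \<open>m / g\<close> is coprime to \<open>q\<close>. Hence
  each of the \<open>g\<close> blocks of \<open>q\<close> consecutive residues, told apart by
  \<open>i div q\<close>, contains at most one solution.\<close>

lemma card_linear_cong_le:
  fixes m c :: int and l :: nat
  assumes "l > 0"
  shows "card {i \<in> {0..<int l}. int l dvd m * i - c} \<le> nat (gcd m (int l))"
proof -
  define g where "g = gcd m (int l)"
  define q where "q = int l div g"
  let ?S = "{i \<in> {0..<int l}. int l dvd m * i - c}"
  have g: "g > 0"
    using assms by (simp add: g_def)
  have lgq: "int l = g * q"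
    by (simp add: g_def q_def)
  have q: "q > 0"
    using lgq assms g by (metis of_nat_0_less_iff zero_less_mult_pos)
  obtain m' where m': "m = g * m'"
    unfolding g_def by (meson dvdE gcd_dvd1)
  have cop: "coprime q m'"
  proof -
    have "gcd m' q = 1"
      using g m' lgq g_def by (metis gcd_mult_distrib_int abs_of_pos mult_cancel_left1 less_irrefl mult.commute)
    then show ?thesis
      by (simp add: coprime_iff_gcd_eq_1 gcd.commute)
  qed
  have "inj_on (\<lambda>i. i div q) ?S"
  proof (rule inj_onI)
    fix i j assume ij: "i \<in> ?S" "j \<in> ?S" and eq: "i div q = j div q"
    have "int l dvd (m * i - c) - (m * j - c)"
      using ij by (blast intro: dvd_diff)
    then have "g * q dvd g * (m' * (i - j))"
      by (simp add: lgq m' algebra_simps)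
    then have "q dvd m' * (i - j)"
      using g by simp
    then have "q dvd i - j"
      using cop coprime_dvd_mult_right_iff by blast
    then have "i mod q = j mod q"
      by (simp add: mod_eq_dvd_iff)
    then show "i = j"
      using eq by (metis mult_div_mod_eq)
  qed
  moreover have "(\<lambda>i. i div q) ` ?S \<subseteq> {0..<g}"
  proof safe
    fix i assume "i \<in> {0..<int l}"
    then have i: "0 \<le> i" "i < q * g"
      by (simp_all add: lgq mult.commute)
    then have "i div q * q < g * q"
      by (smt (verit) mult.commute div_mult_mod_eq pos_mod_sign q)
    then show "i div q \<in> {0..<g}"
      using i q by (simp add: pos_imp_zdiv_nonneg_iff)
  qed
  ultimately have "card ?S \<le> card {0..<g}"
    by (intro card_inj_on_le) auto
  then show ?thesis
    by (simp add: g_def)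
qed


section \<open>Automorphisms on rotations and reflections\<close>

lemma inv_dihedral_group:
  assumes "l > 0" "(i, b) \<in> carrier (dihedral_group l)"
  shows "inv\<^bsub>dihedral_group l\<^esub> (i, b) = (if b then (i, True) else ((- i) mod int l, False))"
proof -
  interpret group "dihedral_group l"
    by (rule group_dihedral_group[OF assms(1)])
  show ?thesis
    by (rule inv_equality) (use assms in \<open>auto simp: dihedral_group_def mod_simps\<close>)
qed

text \<open>Induction on the power of r. Reducing the argument modulo \<open>l\<close> keeps every
  power inside the carrier, where the homomorphism property is available.\<close>

lemma endo_dihedral_rotation:
  assumes "l > 0" and hom: "\<alpha> \<in> hom (dihedral_group l) (dihedral_group l)"
    and r: "\<alpha> (dihedral_r l) = (a, False)"
  shows "\<alpha> (int k mod int l, False) = ((a * int k) mod int l, False)"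
proof (induction k)
  case 0
  have "\<alpha> \<one>\<^bsub>dihedral_group l\<^esub> = \<one>\<^bsub>dihedral_group l\<^esub>"
    using hom_one[OF hom] group_dihedral_group[OF assms(1)] by blast
  then show ?case
    by (simp add: dihedral_group_def)
next
  case (Suc k)
  let ?D = "dihedral_group l"
  have "(int (Suc k) mod int l, False) = dihedral_r l \<otimes>\<^bsub>?D\<^esub> (int k mod int l, False)"
    by (simp add: dihedral_group_def dihedral_r_def mod_simps)
  also have "\<alpha> \<dots> = (a, False) \<otimes>\<^bsub>?D\<^esub> ((a * int k) mod int l, False)"
    using assms(1) dihedral_generators_in_carrier(1)[OF assms(1)]
    by (subst hom_mult[OF hom]) (auto simp: r Suc dihedral_group_def)
  also have "\<dots> = ((a * int (Suc k)) mod int l, False)"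
    by (simp add: dihedral_group_def mod_simps algebra_simps)
  finally show ?case .
qed

text \<open>A reflection squares to one. If r went to a reflection, injectivity would give r a
  trivial square, so \<open>l\<close> would divide 2. This leaves \<open>l = 1\<close>, where r is
  the identity and is therefore fixed. For \<open>l = 2\<close> the group is the Klein four-group,
  whose automorphisms can send r to a reflection.\<close>

lemma auto_dihedral_r:
  assumes "l > 0" "l \<noteq> 2" and aut: "\<alpha> \<in> auto (dihedral_group l)"
  obtains a where "\<alpha> (dihedral_r l) = (a, False)"
proof -
  let ?D = "dihedral_group l"
  have hom: "\<alpha> \<in> hom ?D ?D" and inj: "inj_on \<alpha> (carrier ?D)"
    using aut by (auto simp: auto_def Bij_def bij_betw_def)
  have one: "\<alpha> \<one>\<^bsub>?D\<^esub> = \<one>\<^bsub>?D\<^esub>"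
    using hom_one[OF hom] group_dihedral_group[OF assms(1)] by blast
  note rc = dihedral_generators_in_carrier(1)[OF assms(1)]
  obtain a b where ab: "\<alpha> (dihedral_r l) = (a, b)"
    by fastforce
  have "\<not> b"
  proof
    assume b
    then have "\<alpha> (dihedral_r l \<otimes>\<^bsub>?D\<^esub> dihedral_r l) = \<alpha> \<one>\<^bsub>?D\<^esub>"
      using rc by (simp add: hom_mult[OF hom] ab one) (simp add: dihedral_group_def)
    then have "dihedral_r l \<otimes>\<^bsub>?D\<^esub> dihedral_r l = \<one>\<^bsub>?D\<^esub>"
      using inj rc group_dihedral_group[OF assms(1)]
      by (meson group.is_monoid inj_onD monoid.m_closed monoid.one_closed)
    then have "int l dvd 2"
      by (simp add: dihedral_group_def dihedral_r_def mod_simps dvd_eq_mod_eq_0)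
    then have "l dvd 2"
      by (metis int_dvd_int_iff of_nat_numeral)
    then have "l = 1"
      using \<open>l \<noteq> 2\<close> by (meson prime_nat_iff two_is_prime_nat)
    then have "dihedral_r l = \<one>\<^bsub>?D\<^esub>"
      by (simp add: dihedral_r_def dihedral_group_def)
    then show False
      using one ab \<open>b\<close> by (simp add: dihedral_group_def)
  qed
  then show thesis
    using that ab by simp
qed

lemma card_dihedral_inverted_le:
  assumes l: "l > 0" and aut: "\<alpha> \<in> auto (dihedral_group l)"
  shows "card {g \<in> carrier (dihedral_group l). \<alpha> g = inv\<^bsub>dihedral_group l\<^esub> g} \<le> l + gcd 2 l"
proof (cases "l = 2")
  case True
  have "card {g \<in> carrier (dihedral_group l). \<alpha> g = inv\<^bsub>dihedral_group l\<^esub> g} \<le> card (carrier (dihedral_group l))"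
    by (intro card_mono) (auto simp: dihedral_group_def)
  also have "\<dots> = 4"
    using order_dihedral_group[of l] True by (simp add: Coset.order_def)
  finally show ?thesis
    using True by simp
next
  case False
  let ?D = "dihedral_group l"
  have hom: "\<alpha> \<in> hom ?D ?D"
    using aut by (simp add: auto_def)
  obtain a where a: "\<alpha> (dihedral_r l) = (a, False)"
    using auto_dihedral_r[OF l False aut] .
  obtain c e where ce: "\<alpha> dihedral_s = (c, e)"
    by fastforce
  have rot: "\<alpha> (i, False) = ((a * i) mod int l, False)" if "i \<in> {0..<int l}" for i
    using endo_dihedral_rotation[OF l hom a, of "nat i"] that by simp
  have refl: "\<alpha> (i, True) = ((a * i + c) mod int l, e)" if i: "i \<in> {0..<int l}" for i
  proof -
    have "(i, True) = (i, False) \<otimes>\<^bsub>?D\<^esub> dihedral_s"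
      using i by (simp add: dihedral_group_def dihedral_s_def)
    also have "\<alpha> \<dots> = ((a * i) mod int l, False) \<otimes>\<^bsub>?D\<^esub> (c, e)"
      using i dihedral_generators_in_carrier(2)[OF l]
      by (subst hom_mult[OF hom]) (auto simp: rot ce dihedral_group_def)
    also have "\<dots> = ((a * i + c) mod int l, e)"
      by (simp add: dihedral_group_def mod_simps)
    finally show ?thesis .
  qed
  \<comment> \<open>The subtracted \<open>0\<close> and \<open>- c\<close> bring both congruences
    into the form of \<open>card_linear_cong_le\<close>.\<close>
  define A where "A = {i \<in> {0..<int l}. int l dvd (a + 1) * i - 0}"
  define B where "B = {i \<in> {0..<int l}. int l dvd (a - 1) * i - (- c)}"
  have fin: "finite A" "finite B"
    by (rule finite_subset[of _ "{0..<int l}"]; auto simp: A_def B_def)+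
  have "{g \<in> carrier ?D. \<alpha> g = inv\<^bsub>?D\<^esub> g} \<subseteq> A \<times> {False} \<union> B \<times> {True}"
  proof (rule subrelI)
    fix i b
    assume "(i, b) \<in> {g \<in> carrier ?D. \<alpha> g = inv\<^bsub>?D\<^esub> g}"
    then have ib: "(i, b) \<in> carrier ?D" "\<alpha> (i, b) = inv\<^bsub>?D\<^esub> (i, b)"
      by simp_all
    then have i: "i \<in> {0..<int l}"
      by (auto simp: dihedral_group_def)
    have inv: "\<alpha> (i, b) = (if b then (i, True) else ((- i) mod int l, False))"
      using ib inv_dihedral_group[OF l ib(1)] by simp
    show "(i, b) \<in> A \<times> {False} \<union> B \<times> {True}"
    proof (cases b)
      case True
      then have "(a * i + c) mod int l = i mod int l"
        using inv refl[OF i] i by simp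
      then show ?thesis
        using i True by (simp add: B_def mod_eq_dvd_iff algebra_simps)
    next
      case False
      then have "(a * i) mod int l = (- i) mod int l"
        using inv rot[OF i] by simp
      then show ?thesis
        using i False by (simp add: A_def mod_eq_dvd_iff algebra_simps)
    qed
  qed
  then have "card {g \<in> carrier ?D. \<alpha> g = inv\<^bsub>?D\<^esub> g} \<le> card (A \<times> {False} \<union> B \<times> {True})"
    using fin by (intro card_mono) auto
  also have "\<dots> \<le> card A + card B"
    by (rule order_trans[OF card_Un_le]) (simp add: card_cartesian_product)
  finally have le: "card {g \<in> carrier ?D. \<alpha> g = inv\<^bsub>?D\<^esub> g} \<le> card A + card B" .
  have leA: "card A \<le> nat (gcd (a + 1) (int l))" and leB: "card B \<le> nat (gcd (a - 1) (int l))"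
    unfolding A_def B_def using card_linear_cong_le[OF l] by blast+
  have le_l: "card A \<le> l" "card B \<le> l"
    unfolding A_def B_def by (rule order_trans[OF card_mono[of "{0..<int l}"]]; auto)+
  \<comment> \<open>Modulo \<open>l\<close>, \<open>m\<close> is 2 or -2, so a common divisor of
    \<open>m\<close> and \<open>l\<close> divides 2 as well.\<close>
  have gcd2: "nat (gcd m (int l)) \<le> gcd 2 l" if m: "int l dvd m - 2 \<or> int l dvd m + 2" for m
  proof -
    have "gcd m (int l) dvd 2"
    proof -
      have "gcd m (int l) dvd m - (m - 2) \<or> gcd m (int l) dvd (m + 2) - m"
        using m by (meson dvd_diff dvd_trans gcd_dvd1 gcd_dvd2)
      then show ?thesis by simp
    qed
    then have "gcd m (int l) dvd gcd 2 (int l)"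
      by simp
    then have "gcd m (int l) \<le> gcd 2 (int l)"
      using l by (intro zdvd_imp_le) auto
    also have "\<dots> = int (gcd 2 l)"
      by (metis gcd_int_int_eq of_nat_numeral)
    finally show ?thesis by simp
  qed
  \<comment> \<open>Here the gcd is a proper divisor of \<open>l\<close>, so its cofactor
    \<open>k\<close> is at least 2.\<close>
  have half: "2 * nat (gcd m (int l)) \<le> l" if m: "\<not> int l dvd m" for m
  proof -
    obtain k where k: "int l = gcd m (int l) * k"
      by (meson dvdE gcd_dvd2)
    have g: "gcd m (int l) > 0" using l by simp
    have "k \<noteq> 1"
      using m k by (metis gcd_dvd1 mult.right_neutral)
    moreover have "k > 0"
      using k l g by (metis of_nat_0_less_iff zero_less_mult_pos)
    ultimately have "gcd m (int l) * 2 \<le> gcd m (int l) * k"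
      using g by (intro mult_left_mono) auto
    then have "gcd m (int l) * 2 \<le> int l"
      using k by linarith
    then show ?thesis by linarith
  qed
  \<comment> \<open>If \<open>l\<close> divides \<open>a + 1\<close>, then \<open>a - 1\<close> is
    -2 modulo \<open>l\<close>: all rotations may be inverted, but \<open>gcd2\<close> bounds the
    reflections. If \<open>l\<close> divides \<open>a - 1\<close>, the roles are exchanged. In the
    third case \<open>half\<close> bounds each set by \<open>l / 2\<close>.\<close>
  consider "int l dvd a + 1" | "int l dvd a - 1" | "\<not> int l dvd a + 1" "\<not> int l dvd a - 1"
    by blast
  then have "card A + card B \<le> l + gcd 2 l"
  proof cases
    case 1
    moreover have "a - 1 + 2 = a + 1"
      by simp
    ultimately have "int l dvd a - 1 + 2"
      by (simp only:)
    then have "card B \<le> gcd 2 l"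
      using gcd2[of "a - 1"] leB by linarith
    then show ?thesis using le_l by simp
  next
    case 2
    moreover have "a + 1 - 2 = a - 1"
      by simp
    ultimately have "int l dvd a + 1 - 2"
      by (simp only:)
    then have "card A \<le> gcd 2 l"
      using gcd2[of "a + 1"] leA by linarith
    then show ?thesis using le_l by simp
  next
    case 3
    then show ?thesis
      using half[of "a + 1"] half[of "a - 1"] leA leB by linarith
  qed
  then show ?thesis
    using le by linarith
qed

section \<open>Representations of a group\<close>

lemma is_rep_GL: "is_rep G (n, \<rho>) \<Longrightarrow> g \<in> carrier G \<Longrightarrow> \<rho> g \<in> carrier (GL_complex n)"
  by (auto simp: is_rep_def hom_def)

lemma is_rep_carrier_mat: "is_rep G (n, \<rho>) \<Longrightarrow> g \<in> carrier G \<Longrightarrow> \<rho> g \<in> carrier_mat n n"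
  by (drule (1) is_rep_GL) (simp add: carrier_GL_complex)

lemma mult_GL_complex: "A \<otimes>\<^bsub>GL_complex n\<^esub> B = A * B"
  by (simp add: GL_complex_def units_of_def ring_mat_def)

lemma one_GL_complex: "\<one>\<^bsub>GL_complex n\<^esub> = 1\<^sub>m n"
  by (simp add: GL_complex_def units_of_def ring_mat_def)

lemma is_rep_mult:
  "is_rep G (n, \<rho>) \<Longrightarrow> g \<in> carrier G \<Longrightarrow> h \<in> carrier G \<Longrightarrow> \<rho> (g \<otimes>\<^bsub>G\<^esub> h) = \<rho> g * \<rho> h"
  by (auto simp: is_rep_def hom_def mult_GL_complex)

lemma is_rep_one:
  assumes "group G" "is_rep G (n, \<rho>)"
  shows "\<rho> \<one>\<^bsub>G\<^esub> = 1\<^sub>m n"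
  using hom_one[OF _ assms(1) group_GL_complex] assms(2) by (simp add: is_rep_def one_GL_complex)

text \<open>Invertibility of the matrices comes for free: the image of the inverse element is the
  inverse matrix.\<close>

lemma is_repI:
  assumes "group G"
    and mat: "\<And>g. g \<in> carrier G \<Longrightarrow> \<rho> g \<in> carrier_mat n n"
    and one: "\<rho> \<one>\<^bsub>G\<^esub> = 1\<^sub>m n"
    and mult: "\<And>g h. g \<in> carrier G \<Longrightarrow> h \<in> carrier G \<Longrightarrow> \<rho> (g \<otimes>\<^bsub>G\<^esub> h) = \<rho> g * \<rho> h"
  shows "is_rep G (n, \<rho>)"
proof -
  interpret group G by fact
  have "\<rho> g \<in> carrier (GL_complex n)" if g: "g \<in> carrier G" for g
  proof -
    have "\<rho> (inv\<^bsub>G\<^esub> g) * \<rho> g = 1\<^sub>m n" "\<rho> g * \<rho> (inv\<^bsub>G\<^esub> g) = 1\<^sub>m n"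
      using g by (simp_all flip: mult one)
    then show ?thesis
      using g mat by (auto simp: carrier_GL_complex)
  qed
  then show ?thesis
    using mult by (auto simp: is_rep_def hom_def mult_GL_complex)
qed

lemma irreducible_repD: "irreducible_rep G (n, \<rho>) \<Longrightarrow> is_rep G (n, \<rho>) \<and> n > 0"
  by (simp add: irreducible_rep_def)

section \<open>Isomorphism classes and their degrees\<close>

text \<open>Compose the first intertwiner with the inverse of the second. The target may be
  reducible, as happens in the finiteness argument, whereas \<open>equiv_rep_iso\<close> speaks of
  irreducible representations only.\<close>

lemma rep_iso_common_target:
  assumes rep: "is_rep G (m, \<rho>)" "is_rep G (n, \<sigma>)" "is_rep G (k, \<tau>)"
    and iso: "rep_iso G (m, \<rho>) (k, \<tau>)" "rep_iso G (n, \<sigma>) (k, \<tau>)"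
  shows "rep_iso G (m, \<rho>) (n, \<sigma>)"
proof -
  have dims: "m = k" "n = k"
    using iso by (auto simp: rep_iso_def)
  obtain P where P: "P \<in> carrier (GL_complex k)" "\<And>g. g \<in> carrier G \<Longrightarrow> P * \<rho> g = \<tau> g * P"
    using iso(1) by (auto simp: rep_iso_def)
  obtain Q where Q: "Q \<in> carrier (GL_complex k)" "\<And>g. g \<in> carrier G \<Longrightarrow> Q * \<sigma> g = \<tau> g * Q"
    using iso(2) by (auto simp: rep_iso_def)
  obtain Q' where Q': "Q' \<in> carrier_mat k k" "Q' * Q = 1\<^sub>m k" "Q * Q' = 1\<^sub>m k"
    using Q(1) by (auto simp: carrier_GL_complex)
  have [simp]: "P \<in> carrier_mat k k" "Q \<in> carrier_mat k k" "Q' \<in> carrier_mat k k"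
    using P(1) Q(1) Q'(1) by (auto simp: carrier_GL_complex)
  have Q'_GL: "Q' \<in> carrier (GL_complex k)"
    using Q' by (auto simp: carrier_GL_complex)
  have "Q' \<otimes>\<^bsub>GL_complex k\<^esub> P \<in> carrier (GL_complex k)"
    using group_GL_complex[of k] P(1) Q'_GL by (simp add: group.is_monoid monoid.m_closed)
  then have GL: "Q' * P \<in> carrier (GL_complex k)"
    by (simp add: mult_GL_complex)
  have "(Q' * P) * \<rho> g = \<sigma> g * (Q' * P)" if g: "g \<in> carrier G" for g
  proof -
    have [simp]: "\<rho> g \<in> carrier_mat k k" "\<sigma> g \<in> carrier_mat k k" "\<tau> g \<in> carrier_mat k k"
      using rep[THEN is_rep_carrier_mat, OF g] by (simp_all add: dims)
    note mat = assoc_mult_mat[of _ k k _ k _ k] mult_carrier_mat[of _ k k _ k]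
      left_mult_one_mat[of _ k k] right_mult_one_mat[of _ k k]
    have "(Q' * P) * \<rho> g = Q' * (\<tau> g * P)"
      by (simp add: mat P(2)[OF g])
    also have "\<dots> = Q' * ((\<tau> g * (Q * Q')) * P)"
      by (simp add: Q' mat)
    also have "\<dots> = Q' * ((\<tau> g * Q) * (Q' * P))"
      by (simp add: mat)
    also have "\<dots> = Q' * ((Q * \<sigma> g) * (Q' * P))"
      by (simp only: Q(2)[OF g])
    also have "\<dots> = (Q' * Q) * (\<sigma> g * (Q' * P))"
      by (simp add: mat)
    also have "\<dots> = \<sigma> g * (Q' * P)"
      by (simp add: Q'(2) mat)
    finally show ?thesis .
  qed
  then show ?thesis
    using GL dims by (auto simp: rep_iso_def)
qed

text \<open>A class is determined by any member of \<open>F\<close> isomorphic to its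
  representatives, so choosing one such member embeds the classes into \<open>F\<close>. The list
  \<open>F\<close> may contain reducible or mutually isomorphic representations.\<close>

lemma finite_irreducible_classes:
  assumes "finite F"
    and F: "\<And>\<rho>. irreducible_rep G \<rho> \<Longrightarrow> \<exists>\<sigma>\<in>F. is_rep G \<sigma> \<and> rep_iso G \<rho> \<sigma>"
  shows "finite (irreducible_classes G)"
proof -
  let ?I = "{\<rho>. irreducible_rep G \<rho>}"
  let ?R = "{(\<rho>, \<sigma>). irreducible_rep G \<rho> \<and> irreducible_rep G \<sigma> \<and> rep_iso G \<rho> \<sigma>}"
  define h where "h = (\<lambda>\<rho>. SOME \<sigma>. \<sigma> \<in> F \<and> is_rep G \<sigma> \<and> rep_iso G \<rho> \<sigma>)"
  have h: "h \<rho> \<in> F \<and> is_rep G (h \<rho>) \<and> rep_iso G \<rho> (h \<rho>)" if "irreducible_rep G \<rho>" for \<rho>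
    unfolding h_def by (rule someI_ex) (use F[OF that] in blast)
  \<comment> \<open>\<open>r\<close> picks a representative of each class, and \<open>h\<close> then
    moves it into \<open>F\<close>.\<close>
  define r where "r = (\<lambda>C. SOME \<rho>. irreducible_rep G \<rho> \<and> C = ?R `` {\<rho>})"
  have r: "irreducible_rep G (r C) \<and> C = ?R `` {r C}" if "C \<in> irreducible_classes G" for C
    unfolding r_def
  proof (rule someI_ex)
    show "\<exists>\<rho>. irreducible_rep G \<rho> \<and> C = ?R `` {\<rho>}"
      using that unfolding irreducible_classes_def by (elim quotientE) blast
  qed
  have "inj_on (\<lambda>C. h (r C)) (irreducible_classes G)"
  proof (rule inj_onI)
    fix C D assume CD: "C \<in> irreducible_classes G" "D \<in> irreducible_classes G" and eq: "h (r C) = h (r D)"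
    have irr: "irreducible_rep G (r C)" "irreducible_rep G (r D)"
      using r CD by blast+
    obtain n \<rho> m \<sigma> k \<tau> where rs: "r C = (n, \<rho>)" "r D = (m, \<sigma>)" and hk: "h (r D) = (k, \<tau>)"
      by (metis surj_pair)
    have "rep_iso G (n, \<rho>) (m, \<sigma>)"
    proof (rule rep_iso_common_target)
      show "is_rep G (n, \<rho>)" "is_rep G (m, \<sigma>)"
        using irreducible_repD irr[unfolded rs] by blast+
      show "is_rep G (k, \<tau>)" "rep_iso G (m, \<sigma>) (k, \<tau>)"
        using h[OF irr(2), unfolded hk] by (simp_all add: rs)
      show "rep_iso G (n, \<rho>) (k, \<tau>)"
        using h[OF irr(1), unfolded eq hk] by (simp add: rs)
    qed
    then have "(r C, r D) \<in> ?R"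
      using irr by (simp add: rs)
    then have "?R `` {r C} = ?R `` {r D}"
      by (rule equiv_class_eq[OF equiv_rep_iso])
    moreover have "C = ?R `` {r C}" "D = ?R `` {r D}"
      using r CD by blast+
    ultimately show "C = D"
      by argo
  qed
  moreover have "(\<lambda>C. h (r C)) ` irreducible_classes G \<subseteq> F"
    using h r by blast
  ultimately show ?thesis
    using \<open>finite F\<close> inj_on_finite by blast
qed

text \<open>Pairwise non-isomorphic irreducibles lie in different classes, so their degrees form
  part of the full sum. Finiteness of the set of classes keeps that sum from collapsing to its
  default value 0.\<close>

lemma sum_irreducible_degrees_ge:
  assumes fin: "finite (irreducible_classes G)"
    and irr: "\<And>\<rho>. \<rho> \<in> S \<Longrightarrow> irreducible_rep G \<rho>"
    and noniso: "\<And>\<rho> \<sigma>. \<rho> \<in> S \<Longrightarrow> \<sigma> \<in> S \<Longrightarrow> rep_iso G \<rho> \<sigma> \<Longrightarrow> \<rho> = \<sigma>"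
  shows "(\<Sum>\<rho>\<in>S. fst \<rho>) \<le> sum_irreducible_degrees G"
proof -
  let ?R = "{(\<rho>, \<sigma>). irreducible_rep G \<rho> \<and> irreducible_rep G \<sigma> \<and> rep_iso G \<rho> \<sigma>}"
  let ?c = "\<lambda>\<rho>. ?R `` {\<rho>}"
  have self: "\<rho> \<in> ?c \<rho>" if "\<rho> \<in> S" for \<rho>
    using equiv_class_self[OF equiv_rep_iso, of \<rho> G] irr[OF that] by simp
  have inj: "inj_on ?c S"
  proof (rule inj_onI)
    fix \<rho> \<sigma> assume *: "\<rho> \<in> S" "\<sigma> \<in> S" "?c \<rho> = ?c \<sigma>"
    then have "\<sigma> \<in> ?c \<rho>"
      using self[of \<sigma>] by simp
    then show "\<rho> = \<sigma>"
      using noniso * by simp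
  qed
  have sub: "?c ` S \<subseteq> irreducible_classes G"
    unfolding irreducible_classes_def using irr by (blast intro: quotientI)
  \<comment> \<open>The degree is constant on a class, so the representative picked by
    \<open>SOME\<close> does not affect it.\<close>
  have same_deg: "fst \<sigma> = fst \<rho>" if "\<sigma> \<in> ?c \<rho>" for \<rho> \<sigma>
    using that by (auto simp: rep_iso_def)
  have deg: "fst (SOME \<sigma>. \<sigma> \<in> ?c \<rho>) = fst \<rho>" if "\<rho> \<in> S" for \<rho>
    by (rule same_deg, rule someI, rule self[OF that])
  have "(\<Sum>\<rho>\<in>S. fst \<rho>) = (\<Sum>\<rho>\<in>S. fst (SOME \<sigma>. \<sigma> \<in> ?c \<rho>))"
    using deg by (intro sum.cong) simp_all
  also have "\<dots> = (\<Sum>C\<in>?c ` S. fst (SOME \<sigma>. \<sigma> \<in> C))"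
    by (simp only: sum.reindex[OF inj] comp_def)
  also have "\<dots> \<le> (\<Sum>C\<in>irreducible_classes G. fst (SOME \<sigma>. \<sigma> \<in> C))"
    using fin sub by (rule sum_mono2) simp
  finally show ?thesis
    by (simp add: sum_irreducible_degrees_def)
qed

lemma subspace_module_vecI:
  assumes "W \<subseteq> carrier_vec n" "0\<^sub>v n \<in> W"
    and "\<And>v w. v \<in> W \<Longrightarrow> w \<in> W \<Longrightarrow> v + w \<in> W"
    and "\<And>c v. v \<in> W \<Longrightarrow> c \<cdot>\<^sub>v v \<in> W"
  shows "VectorSpace.subspace class_ring W (module_vec TYPE('a :: field) n)"
  using assms
  by (intro VectorSpace.subspace.intro submodule.intro vec_vs vec_module) (auto simp: module_vec_simps)

lemma subspace_module_vecD:
  assumes "VectorSpace.subspace class_ring W (module_vec TYPE('a :: field) n)"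
  shows "W \<subseteq> carrier_vec n" "0\<^sub>v n \<in> W"
    and "v \<in> W \<Longrightarrow> w \<in> W \<Longrightarrow> v + w \<in> W"
    and "v \<in> W \<Longrightarrow> c \<cdot>\<^sub>v v \<in> W"
  using VectorSpace.subspace.submod[OF assms]
  by (auto simp: submodule_def module_vec_simps class_ring_simps)

section \<open>Representations of the dihedral group\<close>

text \<open>\<open>z\<close> is the intended value at r and \<open>d\<close> the value at s; the
  relations force both to be square roots of 1.\<close>

definition dihedral_char :: "complex \<Rightarrow> complex \<Rightarrow> int \<times> bool \<Rightarrow> complex mat" where
  "dihedral_char z d = (\<lambda>(i, b). mat 1 1 (\<lambda>_. z powi i * (if b then d else 1)))"

text \<open>The rotation \<open>r\<close> acts as \<open>diag(z, z\<^sup>-\<^sup>1)\<close> and \<open>s\<close> swaps the two coordinates.\<close>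

definition dihedral_plane :: "complex \<Rightarrow> int \<times> bool \<Rightarrow> complex mat" where
  "dihedral_plane z = (\<lambda>(i, b). mat 2 2 (\<lambda>(p, q).
     if (p = q) = b then 0 else if p = 0 then z powi i else z powi (- i)))"

lemma powi_mod_root_unity:
  fixes z :: "'a :: field"
  assumes "l > 0" "z ^ l = 1"
  shows "z powi (k mod int l) = z powi k"
proof -
  have "z \<noteq> 0"
    using assms by (auto simp: power_0_left)
  then have "z powi k = z powi (k mod int l) * z powi (int l * (k div int l))"
    by (metis mod_mult_div_eq power_int_add)
  also have "z powi (int l * (k div int l)) = 1"
    using assms(2) by (simp add: power_int_mult)
  finally show ?thesis by simp
qed

lemma powi_minus_mod_root_unity:
  fixes z :: "'a :: field"
  assumes "l > 0" "z ^ l = 1"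
  shows "z powi - (k mod int l) = z powi - k"
  by (simp add: power_int_minus powi_mod_root_unity[OF assms])

lemma is_rep_dihedral_char:
  assumes "l > 0" "z ^ l = 1" "z * z = 1" "d * d = 1"
  shows "is_rep (dihedral_group l) (1, dihedral_char z d)"
proof (rule is_repI)
  have z: "z \<noteq> 0"
    using assms(3) by auto
  \<comment> \<open>Moving s past a rotation inverts the rotation, so multiplicativity requires z to
    the power j to equal its own inverse.\<close>
  have inv: "inverse (z powi k) = z powi k" for k
  proof (rule inverse_unique)
    show "z powi k * z powi k = 1"
      by (simp add: assms(3) flip: power_int_mult_distrib)
  qed
  fix g h
  assume gh: "g \<in> carrier (dihedral_group l)" "h \<in> carrier (dihedral_group l)"
  obtain i b j c where [simp]: "g = (i, b)" "h = (j, c)"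
    by fastforce
  show "dihedral_char z d (g \<otimes>\<^bsub>dihedral_group l\<^esub> h) = dihedral_char z d g * dihedral_char z d h"
    using assms
    by (intro eq_matI)
       (auto simp: dihedral_char_def dihedral_group_def powi_mod_root_unity power_int_add
        power_int_diff z inv scalar_prod_def divide_inverse)
next
  show "group (dihedral_group l)"
    using assms(1) by (rule group_dihedral_group)
qed (auto simp: dihedral_char_def dihedral_group_def)

lemma is_rep_dihedral_plane:
  assumes "l > 0" "z ^ l = 1"
  shows "is_rep (dihedral_group l) (2, dihedral_plane z)"
proof (rule is_repI)
  have z: "z \<noteq> 0"
    using assms by (auto simp: power_0_left)
  fix g h
  assume gh: "g \<in> carrier (dihedral_group l)" "h \<in> carrier (dihedral_group l)"
  obtain i b j c where gh: "g = (i, b)" "h = (j, c)"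
    by fastforce
  show "dihedral_plane z (g \<otimes>\<^bsub>dihedral_group l\<^esub> h) = dihedral_plane z g * dihedral_plane z h"
    unfolding gh
    by (cases b; cases c; intro eq_matI)
       (auto simp: dihedral_plane_def dihedral_group_def powi_mod_root_unity[OF assms]
        powi_minus_mod_root_unity[OF assms] power_int_add power_int_diff power_int_minus
        z scalar_prod_def numeral_2_eq_2 less_Suc_eq field_simps)
next
  show "group (dihedral_group l)"
    using assms(1) by (rule group_dihedral_group)
qed (auto simp: dihedral_plane_def dihedral_group_def intro!: eq_matI)

section \<open>Irreducibility of the characters and planes\<close>

text \<open>Reduces irreducibility to one nonzero vector \<open>w\<close> of an invariant subspace,
  so that the zero subspace is dealt with once.\<close>

lemma irreducible_repI:
  assumes "is_rep G (n, \<rho>)" "n > 0"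
    and "\<And>W w. VectorSpace.subspace class_ring W (module_vec TYPE(complex) n) \<Longrightarrow>
      (\<And>g w. g \<in> carrier G \<Longrightarrow> w \<in> W \<Longrightarrow> \<rho> g *\<^sub>v w \<in> W) \<Longrightarrow> w \<in> W \<Longrightarrow> w \<noteq> 0\<^sub>v n \<Longrightarrow>
      carrier_vec n \<subseteq> W"
  shows "irreducible_rep G (n, \<rho>)"
  unfolding irreducible_rep_def prod.case
proof (intro conjI allI impI assms(1,2))
  fix W assume "invariant_subspace G (n, \<rho>) W"
  then have W: "VectorSpace.subspace class_ring W (module_vec TYPE(complex) n)"
    and inv: "\<And>g w. g \<in> carrier G \<Longrightarrow> w \<in> W \<Longrightarrow> \<rho> g *\<^sub>v w \<in> W"
    by (auto simp: invariant_subspace_def)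
  show "W = {0\<^sub>v n} \<or> W = carrier_vec n"
  proof (cases "\<exists>w\<in>W. w \<noteq> 0\<^sub>v n")
    case True
    then show ?thesis
      using assms(3)[OF W inv] subspace_module_vecD(1)[OF W] by blast
  next
    case False
    then show ?thesis
      using subspace_module_vecD(2)[OF W] by blast
  qed
qed

lemma irreducible_dihedral_char:
  assumes "l > 0" "z ^ l = 1" "z * z = 1" "d * d = 1"
  shows "irreducible_rep (dihedral_group l) (1, dihedral_char z d)"
proof (rule irreducible_repI[OF is_rep_dihedral_char[OF assms]])
  fix W w
  assume W: "VectorSpace.subspace class_ring W (module_vec TYPE(complex) 1)"
    and w: "w \<in> W" "w \<noteq> 0\<^sub>v 1"
  have w1: "w \<in> carrier_vec 1"
    using subspace_module_vecD(1)[OF W] w by blast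
  then have w0: "w $ 0 \<noteq> 0"
    using w(2) by auto
  show "carrier_vec 1 \<subseteq> W"
  proof
    fix x :: "complex vec" assume "x \<in> carrier_vec 1"
    then have "x = (x $ 0 / w $ 0) \<cdot>\<^sub>v w"
      using w0 w1 by (intro eq_vecI) auto
    then show "x \<in> W"
      using subspace_module_vecD(4)[OF W w(1)] by metis
  qed
qed simp

lemma dihedral_plane_r:
  assumes "l > 0" "z ^ l = 1"
  shows "dihedral_plane z (dihedral_r l) =
    mat 2 2 (\<lambda>(p, q). if p \<noteq> q then 0 else if p = 0 then z else inverse z)"
  by (intro eq_matI)
     (auto simp: dihedral_plane_def dihedral_r_def powi_mod_root_unity[OF assms]
      powi_minus_mod_root_unity[OF assms] power_int_minus)

text \<open>As \<open>z * z\<close> is not 1, r has two distinct eigenvalues. Subtracting a suitable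
  multiple of \<open>w\<close> from its image under r isolates one coordinate, which puts a basis
  vector into \<open>W\<close>; s then supplies the other one.\<close>

lemma irreducible_dihedral_plane:
  assumes l: "l > 0" and z: "z ^ l = 1" "z * z \<noteq> 1"
  shows "irreducible_rep (dihedral_group l) (2, dihedral_plane z)"
proof (rule irreducible_repI[OF is_rep_dihedral_plane[OF l z(1)]])
  fix W w
  assume W: "VectorSpace.subspace class_ring W (module_vec TYPE(complex) 2)"
    and inv: "\<And>g w. g \<in> carrier (dihedral_group l) \<Longrightarrow> w \<in> W \<Longrightarrow> dihedral_plane z g *\<^sub>v w \<in> W"
    and w: "w \<in> W" "w \<noteq> 0\<^sub>v 2"
  note add = subspace_module_vecD(3)[OF W] and smult = subspace_module_vecD(4)[OF W]
  have w2: "w \<in> carrier_vec 2"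
    using subspace_module_vecD(1)[OF W] w by blast
  have z0: "z \<noteq> 0"
    using z(1) l by (auto simp: power_0_left)
  have zz: "z - inverse z \<noteq> 0" "inverse z - z \<noteq> 0"
    using z(2) z0 by (auto simp: field_simps)
  have swap: "dihedral_plane z dihedral_s *\<^sub>v unit_vec 2 0 = unit_vec 2 1"
    "dihedral_plane z dihedral_s *\<^sub>v unit_vec 2 1 = unit_vec 2 0"
    by (auto simp: dihedral_plane_def dihedral_s_def scalar_prod_def numeral_2_eq_2 less_Suc_eq
        intro!: eq_vecI)
  have swapW: "unit_vec 2 0 \<in> W \<longleftrightarrow> unit_vec 2 1 \<in> W"
    using inv[OF dihedral_generators_in_carrier(2)[OF l]] swap by metis
  \<comment> \<open>Taking \<open>c = - inverse z\<close> cancels the second coordinate, and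
    \<open>c = - z\<close> the first.\<close>
  have r: "dihedral_plane z (dihedral_r l) *\<^sub>v w + c \<cdot>\<^sub>v w \<in> W" for c
    using inv[OF dihedral_generators_in_carrier(1)[OF l] w(1)] add smult w(1) by blast
  have r_eq: "dihedral_plane z (dihedral_r l) *\<^sub>v w + c \<cdot>\<^sub>v w =
      vec 2 (\<lambda>p. ((if p = 0 then z else inverse z) + c) * w $ p)" for c
    using w2 by (intro eq_vecI) (auto simp: dihedral_plane_r[OF l z(1)] scalar_prod_def
        numeral_2_eq_2 less_Suc_eq distrib_right)
  have "w $ 0 \<noteq> 0 \<or> w $ 1 \<noteq> 0"
    using w(2) w2 by (auto simp: numeral_2_eq_2 less_Suc_eq vec_eq_iff)
  then have "unit_vec 2 0 \<in> W \<or> unit_vec 2 1 \<in> W"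
  proof
    assume w0: "w $ 0 \<noteq> 0"
    have "(1 / ((z - inverse z) * w $ 0)) \<cdot>\<^sub>v
        (dihedral_plane z (dihedral_r l) *\<^sub>v w + (- inverse z) \<cdot>\<^sub>v w) = unit_vec 2 0"
      unfolding r_eq using w0 zz by (intro eq_vecI) (auto simp: unit_vec_def less_2_cases_iff)
    then show ?thesis
      using smult[OF r] by metis
  next
    assume w0: "w $ 1 \<noteq> 0"
    have "(1 / ((inverse z - z) * w $ 1)) \<cdot>\<^sub>v
        (dihedral_plane z (dihedral_r l) *\<^sub>v w + (- z) \<cdot>\<^sub>v w) = unit_vec 2 1"
      unfolding r_eq using w0 zz by (intro eq_vecI) (auto simp: unit_vec_def less_2_cases_iff)
    then show ?thesis
      using smult[OF r] by metis
  qed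
  then have e: "unit_vec 2 0 \<in> W" "unit_vec 2 1 \<in> W"
    using swapW by blast+
  show "carrier_vec 2 \<subseteq> W"
  proof
    fix x :: "complex vec" assume "x \<in> carrier_vec 2"
    then have "x = x $ 0 \<cdot>\<^sub>v unit_vec 2 0 + x $ 1 \<cdot>\<^sub>v unit_vec 2 1"
      by (intro eq_vecI) (auto simp: numeral_2_eq_2 less_Suc_eq unit_vec_def)
    then show "x \<in> W"
      using add smult e by metis
  qed
qed simp

section \<open>Isomorphisms among the characters and among the planes\<close>

text \<open>In degree one an intertwiner is a nonzero scalar, which cancels. Evaluation at r and at
  s then recovers the two parameters.\<close>

lemma rep_iso_dihedral_char:
  assumes l: "l > 0" and z: "z ^ l = 1" "z' ^ l = 1"
    and iso: "rep_iso (dihedral_group l) (1, dihedral_char z d) (1, dihedral_char z' d')"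
  shows "z = z' \<and> d = d'"
proof -
  obtain P where P: "P \<in> carrier (GL_complex 1)" and
    PG: "\<And>g. g \<in> carrier (dihedral_group l) \<Longrightarrow> P * dihedral_char z d g = dihedral_char z' d' g * P"
    using iso by (auto simp: rep_iso_def)
  obtain Q where Q: "P \<in> carrier_mat 1 1" "Q \<in> carrier_mat 1 1" "P * Q = 1\<^sub>m 1"
    using P by (auto simp: carrier_GL_complex)
  have "(P * Q) $$ (0, 0) = 1"
    by (simp add: Q(3))
  then have P0: "P $$ (0, 0) \<noteq> 0"
    using Q(1,2) by (auto simp: scalar_prod_def)
  have *: "P $$ (0, 0) * dihedral_char z d g $$ (0, 0) = dihedral_char z' d' g $$ (0, 0) * P $$ (0, 0)"
    if g: "g \<in> carrier (dihedral_group l)" for g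
  proof -
    obtain i b where "g = (i, b)"
      by fastforce
    then show ?thesis
      using arg_cong[OF PG[OF g], of "\<lambda>M. M $$ (0, 0)"] Q(1)
      by (simp add: dihedral_char_def scalar_prod_def)
  qed
  show ?thesis
    using *[OF dihedral_generators_in_carrier(1)[OF l]] *[OF dihedral_generators_in_carrier(2)[OF l]] P0
    by (simp add: dihedral_char_def dihedral_r_def dihedral_s_def powi_mod_root_unity[OF l] z)
qed

text \<open>An intertwiner maps eigenvectors of r to eigenvectors for the same eigenvalue. If
  \<open>z'\<close> is neither \<open>z\<close> nor its inverse, the first row of \<open>P\<close>
  vanishes and \<open>P\<close> is not invertible.\<close>

lemma rep_iso_dihedral_plane:
  assumes l: "l > 0" and z: "z ^ l = 1" "z' ^ l = 1"
    and iso: "rep_iso (dihedral_group l) (2, dihedral_plane z) (2, dihedral_plane z')"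
  shows "z = z' \<or> z * z' = 1"
proof (rule ccontr)
  assume neq: "\<not> (z = z' \<or> z * z' = 1)"
  have z0: "z \<noteq> 0"
    using z(1) l by (auto simp: power_0_left)
  obtain P where P: "P \<in> carrier (GL_complex 2)" and
    PG: "\<And>g. g \<in> carrier (dihedral_group l) \<Longrightarrow> P * dihedral_plane z g = dihedral_plane z' g * P"
    using iso by (auto simp: rep_iso_def)
  obtain Q where Q: "P \<in> carrier_mat 2 2" "Q \<in> carrier_mat 2 2" "P * Q = 1\<^sub>m 2"
    using P by (auto simp: carrier_GL_complex)
  note eq = PG[OF dihedral_generators_in_carrier(1)[OF l], unfolded dihedral_plane_r[OF l z(1)] dihedral_plane_r[OF l z(2)]]
  have "P $$ (0, 0) * z = z' * P $$ (0, 0)"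
    using arg_cong[OF eq, of "\<lambda>M. M $$ (0, 0)"] Q(1)
    by (simp add: scalar_prod_def numeral_2_eq_2)
  then have P00: "P $$ (0, 0) = 0"
    using neq by auto
  have "P $$ (0, 1) * inverse z = z' * P $$ (0, 1)"
    using arg_cong[OF eq, of "\<lambda>M. M $$ (0, 1)"] Q(1)
    by (simp add: scalar_prod_def numeral_2_eq_2)
  then have P01: "P $$ (0, 1) = 0"
    using neq z0 by (auto simp: field_simps)
  have "(P * Q) $$ (0, 0) = 0"
    using Q(1,2) P00 P01 by (simp add: scalar_prod_def numeral_2_eq_2)
  then show False
    by (simp add: Q(3))
qed

section \<open>Classification of the irreducible representations\<close>

text \<open>Over the complex numbers r has an eigenvector \<open>v\<close>. Since conjugation by s
  inverts r, the vector \<open>w\<close> obtained by applying s to \<open>v\<close> is an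
  eigenvector for the inverse eigenvalue. Rotations preserve the two lines, and reflections exchange
  them.\<close>

lemma dihedral_rep_eigenvector:
  assumes l: "l > 0" and rep: "is_rep (dihedral_group l) (n, \<rho>)" and n: "n > 0"
  obtains v w z where "v \<in> carrier_vec n" "w \<in> carrier_vec n" "v \<noteq> 0\<^sub>v n" "w \<noteq> 0\<^sub>v n" "z ^ l = 1"
    and "\<And>i b. (i, b) \<in> carrier (dihedral_group l) \<Longrightarrow>
      \<rho> (i, b) *\<^sub>v v = (if b then z powi (- i) \<cdot>\<^sub>v w else z powi i \<cdot>\<^sub>v v)"
    and "\<And>i b. (i, b) \<in> carrier (dihedral_group l) \<Longrightarrow>
      \<rho> (i, b) *\<^sub>v w = (if b then z powi i \<cdot>\<^sub>v v else z powi (- i) \<cdot>\<^sub>v w)"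
proof -
  let ?D = "dihedral_group l"
  have carr: "(i, b) \<in> carrier ?D \<longleftrightarrow> i \<in> {0..<int l}" for i b
    by (auto simp: dihedral_group_def)
  note rc = dihedral_generators_in_carrier(1)[OF l] and sc = dihedral_generators_in_carrier(2)[OF l]
  note mat = is_rep_carrier_mat[OF rep]
  have act: "\<rho> (g \<otimes>\<^bsub>?D\<^esub> h) *\<^sub>v x = \<rho> g *\<^sub>v (\<rho> h *\<^sub>v x)"
    if "g \<in> carrier ?D" "h \<in> carrier ?D" "x \<in> carrier_vec n" for g h x
    using that mat by (simp add: is_rep_mult[OF rep] assoc_mult_mat_vec[of _ n n _ n])
  have one: "\<rho> (0, False) *\<^sub>v x = x" if "x \<in> carrier_vec n" for x
    using is_rep_one[OF group_dihedral_group[OF l] rep] that by (simp add: dihedral_group_def)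
  have "spectrum (\<rho> (dihedral_r l)) \<noteq> {}"
    using mat[OF rc] n by (rule spectrum_non_empty)
  then obtain z v where ev: "eigenvector (\<rho> (dihedral_r l)) v z"
    by (auto simp: spectrum_def eigenvalue_def)
  have v: "v \<in> carrier_vec n" "v \<noteq> 0\<^sub>v n" "\<rho> (dihedral_r l) *\<^sub>v v = z \<cdot>\<^sub>v v"
    using ev carrier_matD(1)[OF mat[OF rc]] by (auto simp: eigenvector_def)
  \<comment> \<open>Cancelling the nonzero vector \<open>v\<close> turns the triviality of the
    \<open>l\<close>-th power of r into \<open>z ^ l = 1\<close>.\<close>
  have smult_eq: "a = b" if "a \<cdot>\<^sub>v v = b \<cdot>\<^sub>v v" for a b
  proof -
    obtain p where "p < n" "v $ p \<noteq> 0"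
      using v(1,2) by (metis carrier_vecD dim_vec eq_vecI index_zero_vec(1) index_zero_vec(2))
    then show ?thesis
      using arg_cong[OF that, of "\<lambda>x. x $ p"] v(1) by simp
  qed
  have pow: "\<rho> (int k mod int l, False) *\<^sub>v v = z ^ k \<cdot>\<^sub>v v" for k
  proof (induction k)
    case 0
    then show ?case using one v(1) by simp
  next
    case (Suc k)
    have "(int (Suc k) mod int l, False) = dihedral_r l \<otimes>\<^bsub>?D\<^esub> (int k mod int l, False)"
      by (simp add: dihedral_group_def dihedral_r_def mod_simps)
    then have "\<rho> (int (Suc k) mod int l, False) *\<^sub>v v = \<rho> (dihedral_r l) *\<^sub>v (z ^ k \<cdot>\<^sub>v v)"
      using act[OF rc _ v(1)] l Suc by (simp add: carr)
    then show ?case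
      using mult_mat_vec[OF mat[OF rc] v(1)] v by (simp add: smult_smult_assoc mult.commute)
  qed
  have "1 \<cdot>\<^sub>v v = z ^ l \<cdot>\<^sub>v v"
    using pow[of l] one[OF v(1)] by simp
  then have zl: "z ^ l = 1"
    using smult_eq by metis
  define w where "w = \<rho> dihedral_s *\<^sub>v v"
  have w: "w \<in> carrier_vec n"
    using mat[OF sc] v(1) by (simp add: w_def)
  have sw: "\<rho> dihedral_s *\<^sub>v w = v"
  proof -
    have "dihedral_s \<otimes>\<^bsub>?D\<^esub> dihedral_s = (0, False)"
      by (simp add: dihedral_group_def dihedral_s_def)
    then show ?thesis
      using act[OF sc sc v(1)] one[OF v(1)] by (simp add: w_def)
  qed
  have "\<rho> dihedral_s *\<^sub>v 0\<^sub>v n = 0\<^sub>v n"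
    using mat[OF sc] by (intro eq_vecI) auto
  then have w0: "w \<noteq> 0\<^sub>v n"
    using sw v(2) by auto
  have rot_v: "\<rho> (i, False) *\<^sub>v v = z powi i \<cdot>\<^sub>v v" if "i \<in> {0..<int l}" for i
    using pow[of "nat i"] that by (simp add: power_int_nonneg_exp)
  have refl_v: "\<rho> (i, True) *\<^sub>v v = z powi (- i) \<cdot>\<^sub>v w" if i: "i \<in> {0..<int l}" for i
  proof -
    \<comment> \<open>Writing the reflection with s on the left lets a rotation act on the
      eigenvector \<open>v\<close> first.\<close>
    have "(i, True) = dihedral_s \<otimes>\<^bsub>?D\<^esub> ((- i) mod int l, False)"
      using i by (simp add: dihedral_group_def dihedral_s_def mod_simps)
    then have "\<rho> (i, True) *\<^sub>v v = \<rho> dihedral_s *\<^sub>v (z powi (- i) \<cdot>\<^sub>v v)"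
      using act[OF sc _ v(1)] l by (simp add: carr rot_v powi_mod_root_unity[OF l zl])
    then show ?thesis
      using mult_mat_vec[OF mat[OF sc] v(1)] by (simp add: w_def)
  qed
  have rot_w: "\<rho> (i, False) *\<^sub>v w = z powi (- i) \<cdot>\<^sub>v w" if i: "i \<in> {0..<int l}" for i
  proof -
    have "(i, False) \<otimes>\<^bsub>?D\<^esub> dihedral_s = (i, True)"
      using i by (simp add: dihedral_group_def dihedral_s_def)
    then show ?thesis
      using act[OF _ sc v(1), of "(i, False)"] refl_v[OF i] i by (simp add: carr w_def)
  qed
  have refl_w: "\<rho> (i, True) *\<^sub>v w = z powi i \<cdot>\<^sub>v v" if i: "i \<in> {0..<int l}" for i
  proof -
    have "(i, False) \<otimes>\<^bsub>?D\<^esub> dihedral_s = (i, True)"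
      using i by (simp add: dihedral_group_def dihedral_s_def)
    then show ?thesis
      using act[OF _ sc w, of "(i, False)"] rot_v[OF i] i by (simp add: carr sw)
  qed
  show thesis
    by (rule that[OF v(1) w v(2) w0 zl]) (auto simp: carr rot_v rot_w refl_v refl_w)
qed

text \<open>The span of \<open>v\<close> and \<open>w\<close> is invariant and contains the nonzero
  \<open>v\<close>, so irreducibility makes it the whole space.\<close>

lemma irreducible_dihedral_rep_spanned:
  assumes l: "l > 0" and irr: "irreducible_rep (dihedral_group l) (n, \<rho>)"
    and v: "v \<in> carrier_vec n" "v \<noteq> 0\<^sub>v n" and w: "w \<in> carrier_vec n"
    and act_v: "\<And>i b. (i, b) \<in> carrier (dihedral_group l) \<Longrightarrow>
      \<rho> (i, b) *\<^sub>v v = (if b then z powi (- i) \<cdot>\<^sub>v w else z powi i \<cdot>\<^sub>v v)"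
    and act_w: "\<And>i b. (i, b) \<in> carrier (dihedral_group l) \<Longrightarrow>
      \<rho> (i, b) *\<^sub>v w = (if b then z powi i \<cdot>\<^sub>v v else z powi (- i) \<cdot>\<^sub>v w)"
    and u: "u \<in> carrier_vec n"
  shows "\<exists>x y. u = x \<cdot>\<^sub>v v + y \<cdot>\<^sub>v w"
proof -
  let ?D = "dihedral_group l"
  have rep: "is_rep ?D (n, \<rho>)"
    using irreducible_repD[OF irr] by simp
  define W where "W = {x \<cdot>\<^sub>v v + y \<cdot>\<^sub>v w | x y. True}"
  have "invariant_subspace ?D (n, \<rho>) W"
    unfolding invariant_subspace_def prod.case
  proof (intro conjI ballI subspace_module_vecI)
    show "W \<subseteq> carrier_vec n"
      using v w by (auto simp: W_def)
    show "0\<^sub>v n \<in> W"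
      using v w by (auto simp: W_def intro!: exI[of _ 0])
  next
    fix a b assume "a \<in> W" "b \<in> W"
    then obtain x y x' y' where "a = x \<cdot>\<^sub>v v + y \<cdot>\<^sub>v w" "b = x' \<cdot>\<^sub>v v + y' \<cdot>\<^sub>v w"
      by (auto simp: W_def)
    then have "a + b = (x + x') \<cdot>\<^sub>v v + (y + y') \<cdot>\<^sub>v w"
      using v w by (intro eq_vecI) (auto simp: algebra_simps)
    then show "a + b \<in> W"
      by (auto simp: W_def)
  next
    fix c a assume "a \<in> W"
    then obtain x y where "a = x \<cdot>\<^sub>v v + y \<cdot>\<^sub>v w"
      by (auto simp: W_def)
    then have "c \<cdot>\<^sub>v a = (c * x) \<cdot>\<^sub>v v + (c * y) \<cdot>\<^sub>v w"
      using v w by (intro eq_vecI) (auto simp: algebra_simps)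
    then show "c \<cdot>\<^sub>v a \<in> W"
      by (auto simp: W_def)
  next
    fix g a assume g: "g \<in> carrier ?D" and "a \<in> W"
    then obtain x y where a: "a = x \<cdot>\<^sub>v v + y \<cdot>\<^sub>v w"
      by (auto simp: W_def)
    obtain i b where ib: "g = (i, b)"
      by fastforce
    note m = is_rep_carrier_mat[OF rep g]
    have "\<rho> g *\<^sub>v a = x \<cdot>\<^sub>v (\<rho> g *\<^sub>v v) + y \<cdot>\<^sub>v (\<rho> g *\<^sub>v w)"
      using v w mult_mat_vec[OF m] mult_add_distrib_mat_vec[OF m] by (simp add: a)
    also have "\<dots> = (if b then (y * z powi i) \<cdot>\<^sub>v v + (x * z powi (- i)) \<cdot>\<^sub>v w
        else (x * z powi i) \<cdot>\<^sub>v v + (y * z powi (- i)) \<cdot>\<^sub>v w)"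
      using v w act_v act_w g ib by (intro eq_vecI) (auto simp: algebra_simps)
    finally show "\<rho> g *\<^sub>v a \<in> W"
      by (auto simp: W_def)
  qed
  then have "W = {0\<^sub>v n} \<or> W = carrier_vec n"
    using irr by (auto simp: irreducible_rep_def)
  moreover have "v = 1 \<cdot>\<^sub>v v + 0 \<cdot>\<^sub>v w"
    using v w by (intro eq_vecI) auto
  then have "v \<in> W"
    unfolding W_def by blast
  ultimately have "u \<in> W"
    using v u by auto
  then show ?thesis
    by (auto simp: W_def)
qed

text \<open>In degree one, \<open>v\<close> and \<open>w\<close> are proportional, and comparing the
  action on both gives \<open>z * z = 1\<close> and \<open>d * d = 1\<close>. In higher degree,
  \<open>v\<close> and \<open>w\<close> span the space, so the degree is 2 and they form a basis on
  which the group acts as in \<open>dihedral_plane\<close>.\<close>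

lemma irreducible_dihedral_rep_cases:
  assumes l: "l > 0" and irr: "irreducible_rep (dihedral_group l) (n, \<rho>)"
  obtains (char) z d where "z ^ l = 1" "z * z = 1" "d * d = 1"
      "rep_iso (dihedral_group l) (n, \<rho>) (1, dihedral_char z d)"
  | (plane) z where "z ^ l = 1" "rep_iso (dihedral_group l) (n, \<rho>) (2, dihedral_plane z)"
proof -
  let ?D = "dihedral_group l"
  have rep: "is_rep ?D (n, \<rho>)" and n: "n > 0"
    using irreducible_repD[OF irr] by simp_all
  obtain v w z where v: "v \<in> carrier_vec n" "v \<noteq> 0\<^sub>v n"
    and w: "w \<in> carrier_vec n" "w \<noteq> 0\<^sub>v n" and z: "z ^ l = 1"
    and act_v: "\<And>i b. (i, b) \<in> carrier ?D \<Longrightarrow>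
      \<rho> (i, b) *\<^sub>v v = (if b then z powi (- i) \<cdot>\<^sub>v w else z powi i \<cdot>\<^sub>v v)"
    and act_w: "\<And>i b. (i, b) \<in> carrier ?D \<Longrightarrow>
      \<rho> (i, b) *\<^sub>v w = (if b then z powi i \<cdot>\<^sub>v v else z powi (- i) \<cdot>\<^sub>v w)"
    using dihedral_rep_eigenvector[OF l rep n] by metis
  have z0: "z \<noteq> 0"
    using z l by (auto simp: power_0_left)
  note mat = is_rep_carrier_mat[OF rep]
  show thesis
  proof (cases "n = 1")
    case True
    define d where "d = w $ 0 / v $ 0"
    have v0: "v $ 0 \<noteq> 0" and w0: "w $ 0 \<noteq> 0"
      using v w True by auto
    have entry: "\<rho> g $$ (0, 0) * x $ 0 = (\<rho> g *\<^sub>v x) $ 0"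
      if "g \<in> carrier ?D" "x \<in> carrier_vec n" for g x
      using that mat[OF that(1)] True by (simp add: scalar_prod_def)
    have ev: "\<rho> (i, b) $$ (0, 0) = (if b then z powi (- i) * d else z powi i)"
      and ew: "\<rho> (i, b) $$ (0, 0) = (if b then z powi i / d else z powi (- i))"
      if "(i, b) \<in> carrier ?D" for i b
      using entry[OF that v(1)] entry[OF that w(1)] act_v[OF that] act_w[OF that] v w True v0 w0
      by (auto simp: d_def field_simps split: if_splits)
    have "d * d = 1"
      using ev[of 0 True] ew[of 0 True] l v0 w0
      by (simp add: dihedral_group_def d_def field_simps)
    have zz: "z powi i = z powi (- i)" if "i \<in> {0..<int l}" for i
      using ev[of i False] ew[of i False] that by (simp add: dihedral_group_def)
    \<comment> \<open>The exponent enters as \<open>1 mod int l\<close> because for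
      \<open>l = 1\<close> the pair \<open>(1, False)\<close> is outside the carrier.\<close>
    have "z powi 1 = z powi (- 1)"
      using zz[of "1 mod int l"] l
      by (simp only: powi_mod_root_unity[OF l z] powi_minus_mod_root_unity[OF l z]) simp
    then have "z * z = 1"
      using z0 by (simp add: power_int_minus field_simps)
    moreover have "rep_iso ?D (n, \<rho>) (1, dihedral_char z d)"
      unfolding rep_iso_def prod.case
    proof (intro conjI bexI ballI)
      show "n = 1" by fact
      show "1\<^sub>m 1 \<in> carrier (GL_complex 1)"
        by (auto simp: carrier_GL_complex)
      fix g assume g: "g \<in> carrier ?D"
      obtain i b where ib: "g = (i, b)"
        by fastforce
      have "\<rho> g = dihedral_char z d g"
        using mat[OF g] True ev[of i b] zz[of i] g ib
        by (intro eq_matI) (auto simp: dihedral_char_def dihedral_group_def)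
      then show "1\<^sub>m 1 * \<rho> g = dihedral_char z d g * 1\<^sub>m 1"
        using left_mult_one_mat[OF mat[OF g]] right_mult_one_mat[OF mat[OF g]] True by simp
    qed
    ultimately show thesis
      using char z \<open>d * d = 1\<close> by blast
  next
    case False
    have "\<exists>x y. unit_vec n j = x \<cdot>\<^sub>v v + y \<cdot>\<^sub>v w" for j
      by (rule irreducible_dihedral_rep_spanned[OF l irr v w(1) act_v act_w unit_vec_carrier])
    then obtain x y where xy: "\<And>j. unit_vec n j = x j \<cdot>\<^sub>v v + y j \<cdot>\<^sub>v w"
      by metis
    \<comment> \<open>The columns \<open>v\<close>, \<open>w\<close> and the rows of coefficients
      are padded with zeros to size \<open>n\<close>. Both matrices are then square, so the right
      inverse \<open>Q\<close> is also a left inverse even before \<open>n = 2\<close> is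
      known.\<close>
    define P where "P = mat n n (\<lambda>(p, q). if q = 0 then v $ p else if q = 1 then w $ p else 0)"
    define Q where "Q = mat n n (\<lambda>(p, q). if p = 0 then x q else if p = 1 then y q else 0)"
    have [simp]: "P \<in> carrier_mat n n" "Q \<in> carrier_mat n n"
      by (simp_all add: P_def Q_def)
    have "P * Q = 1\<^sub>m n"
    proof (rule eq_matI)
      fix p q assume pq: "p < dim_row (1\<^sub>m n :: complex mat)" "q < dim_col (1\<^sub>m n :: complex mat)"
      have "(P * Q) $$ (p, q) = (\<Sum>k\<in>{0..<n}. P $$ (p, k) * Q $$ (k, q))"
        using pq by (simp add: scalar_prod_def P_def Q_def)
      also have "\<dots> = (\<Sum>k\<in>{0, 1}. P $$ (p, k) * Q $$ (k, q))"
        using pq n False by (intro sum.mono_neutral_right) (auto simp: P_def)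
      also have "\<dots> = v $ p * x q + w $ p * y q"
        using pq n False by (simp add: P_def Q_def)
      also have "\<dots> = unit_vec n q $ p"
        using pq v w by (simp add: xy)
      finally show "(P * Q) $$ (p, q) = 1\<^sub>m n $$ (p, q)"
        using pq by simp
    qed (simp_all add: P_def Q_def)
    then have QP: "Q * P = 1\<^sub>m n"
      using mat_mult_left_right_inverse[of P n Q] by simp
    have n2: "n = 2"
    proof (rule ccontr)
      assume "n \<noteq> 2"
      then have "n > 2"
        using n False by simp
      \<comment> \<open>For \<open>n > 2\<close> the row of \<open>Q\<close> with index 2 is
        padding, while the identity has a 1 there.\<close>
      then have "(Q * P) $$ (2, 2) = 0"
        by (simp add: scalar_prod_def P_def Q_def)
      then show False
        using QP \<open>n > 2\<close> by simp
    qed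
    have PG: "\<rho> g * P = P * dihedral_plane z g" if g: "g \<in> carrier ?D" for g
    proof -
      obtain i b where ib: "g = (i, b)"
        by fastforce
      have cols: "col P 0 = v" "col P 1 = w"
        using v w n2 by (auto simp: P_def intro!: eq_vecI)
      have "(\<rho> g * P) $$ (p, q) = (P * dihedral_plane z g) $$ (p, q)" if "p < 2" "q < 2" for p q
      proof -
        have "(\<rho> g * P) $$ (p, q) = (\<rho> g *\<^sub>v col P q) $ p"
          using that mat[OF g] n2 by (simp add: P_def)
        then show ?thesis
          using that act_v[of i b] act_w[of i b] g ib cols v w n2
          by (auto simp: numeral_2_eq_2 less_Suc_eq scalar_prod_def P_def dihedral_plane_def)
      qed
      moreover have "dihedral_plane z g \<in> carrier_mat 2 2"
        by (simp add: dihedral_plane_def split: prod.splits)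
      ultimately show ?thesis
        using mat[OF g] n2 by (intro eq_matI) (auto simp: P_def)
    qed
    \<comment> \<open>\<open>P\<close> intertwines from the plane to \<rho>, but
      \<open>rep_iso\<close> asks for the opposite direction, hence its inverse
      \<open>Q\<close>.\<close>
    have "Q * \<rho> g = dihedral_plane z g * Q" if g: "g \<in> carrier ?D" for g
    proof -
      have R: "dihedral_plane z g \<in> carrier_mat n n"
        using n2 by (simp add: dihedral_plane_def split: prod.splits)
      note simps = assoc_mult_mat[of _ n n _ n _ n] mult_carrier_mat[of _ n n _ n]
        left_mult_one_mat[of _ n n] right_mult_one_mat[of _ n n]
      have "Q * \<rho> g = Q * (\<rho> g * (P * Q))"
        using \<open>P * Q = 1\<^sub>m n\<close> mat[OF g] by (simp add: simps)
      also have "\<dots> = Q * ((\<rho> g * P) * Q)"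
        using mat[OF g] by (simp add: simps)
      also have "\<dots> = (Q * P) * (dihedral_plane z g * Q)"
        using R by (simp add: PG[OF g] simps)
      also have "\<dots> = dihedral_plane z g * Q"
        using R by (simp add: QP simps)
      finally show ?thesis .
    qed
    moreover have "Q \<in> carrier (GL_complex n)"
      using QP \<open>P * Q = 1\<^sub>m n\<close> by (auto simp: carrier_GL_complex)
    ultimately have "rep_iso ?D (n, \<rho>) (2, dihedral_plane z)"
      unfolding rep_iso_def prod.case using n2 by (intro conjI bexI[of _ Q] ballI) simp_all
    then show thesis
      using plane z by blast
  qed
qed

lemma finite_irreducible_classes_dihedral:
  assumes l: "l > 0"
  shows "finite (irreducible_classes (dihedral_group l))"
proof (rule finite_irreducible_classes)
  \<comment> \<open>This list overcounts: planes with \<open>z\<close> equal to 1 or -1 are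
    reducible, and inverse parameters give isomorphic planes. Finiteness is unaffected.\<close>
  let ?F = "(\<lambda>(z, d). (1 :: nat, dihedral_char z d)) ` ({z. z ^ l = 1 \<and> z * z = 1} \<times> {d. d * d = 1}) \<union>
    (\<lambda>z. (2, dihedral_plane z)) ` {z. z ^ l = 1}"
  have "finite {d :: complex. d * d = 1}"
    using finite_roots_unity[of 2, where 'a = complex] by (simp add: power2_eq_square)
  moreover have "finite {z :: complex. z ^ l = 1}"
    using l by (intro finite_roots_unity) simp
  ultimately show "finite ?F"
    by (auto simp: Collect_conj_eq)
  fix \<rho> :: "(int \<times> bool) rep"
  assume irr: "irreducible_rep (dihedral_group l) \<rho>"
  obtain n \<sigma> where \<rho>: "\<rho> = (n, \<sigma>)"
    by fastforce
  show "\<exists>\<sigma>\<in>?F. is_rep (dihedral_group l) \<sigma> \<and> rep_iso (dihedral_group l) \<rho> \<sigma>"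
    using l irr[unfolded \<rho>]
  proof (cases rule: irreducible_dihedral_rep_cases)
    case (char z d)
    then show ?thesis
      using is_rep_dihedral_char[OF l char(1-3)] \<rho> by (intro bexI[of _ "(1, dihedral_char z d)"]) auto
  next
    case (plane z)
    then show ?thesis
      using is_rep_dihedral_plane[OF l plane(1)] \<rho> by (intro bexI[of _ "(2, dihedral_plane z)"]) auto
  qed
qed

section \<open>The sum of the degrees\<close>

lemma gcd_2_nat: "gcd 2 l = (if even l then 2 else 1)" for l :: nat
proof (cases "even l")
  case True
  then show ?thesis
    by (simp add: gcd_nat.absorb1)
next
  case False
  then have "coprime 2 l"
    by simp
  then show ?thesis
    using False by (simp add: coprime_iff_gcd_eq_1)
qed

text \<open>Conjugation pairs the roots above and below the real axis. A real root has absolute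
  value 1, so it is 1 or, for even \<open>l\<close>, -1, which makes \<open>gcd 2 l\<close> real
  roots in total.\<close>

lemma card_roots_unity_upper_half:
  assumes "l > 0"
  shows "2 * card {z :: complex. z ^ l = 1 \<and> Im z > 0} + gcd 2 l = l"
proof -
  let ?U = "{z :: complex. z ^ l = 1 \<and> Im z > 0}"
  let ?L = "{z :: complex. z ^ l = 1 \<and> Im z < 0}"
  let ?R = "{z :: complex. z ^ l = 1 \<and> Im z = 0}"
  have fin: "finite {z :: complex. z ^ l = 1}"
    using assms by (intro finite_roots_unity) simp
  have [simp]: "finite ?U" "finite ?L" "finite ?R"
    by (rule finite_subset[OF _ fin]; auto)+
  have "bij_betw cnj ?U ?L"
    by (rule bij_betwI[where g = cnj]) (auto simp flip: complex_cnj_power)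
  then have L: "card ?L = card ?U"
    using bij_betw_same_card by force
  have real: "z = 1 \<or> z = - 1" if "z ^ l = 1" "Im z = 0" for z :: complex
  proof -
    have "norm z = 1"
      using power_eq_1_iff[OF that(1)] assms by simp
    moreover have "norm z = \<bar>Re z\<bar>"
      using that(2) by (simp add: cmod_def)
    ultimately have "Re z = 1 \<or> Re z = - 1"
      by linarith
    then show ?thesis
      using that(2) by (auto simp: complex_eq_iff)
  qed
  have "?R = (if even l then {1, - 1} else {1})"
  proof (rule Set.set_eqI)
    fix z :: complex
    show "z \<in> ?R \<longleftrightarrow> z \<in> (if even l then {1, - 1} else {1})"
      using real[of z] by (cases "z = 1"; cases "z = - 1") auto
  qed
  then have R: "card ?R = gcd 2 l"
    by (simp add: gcd_2_nat)
  have "{z :: complex. z ^ l = 1} = ?U \<union> (?L \<union> ?R)"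
    by force
  then have "l = card (?U \<union> (?L \<union> ?R))"
    using card_roots_unity_eq[OF assms] by simp
  also have "\<dots> = card ?U + (card ?L + card ?R)"
    by (subst card_Un_disjoint; (subst card_Un_disjoint)?; auto)
  finally show ?thesis
    using L R by simp
qed

text \<open>The planes in \<open>X\<close> contribute \<open>2 * card U\<close> and the characters
  in \<open>Y\<close> contribute \<open>2 * gcd 2 l\<close>; the count of roots of unity turns the
  total into \<open>l + gcd 2 l\<close>.\<close>

lemma sum_irreducible_degrees_dihedral_ge:
  assumes l: "l > 0"
  shows "l + gcd 2 l \<le> sum_irreducible_degrees (dihedral_group l)"
proof -
  define U where "U = {z :: complex. z ^ l = 1 \<and> Im z > 0}"
  define R where "R = (if even l then {1, - 1} else {1 :: complex})"
  define X where "X = (\<lambda>z. (2 :: nat, dihedral_plane z)) ` U"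
  define Y where "Y = (\<lambda>(z, d). (1 :: nat, dihedral_char z d)) ` (R \<times> {1, - 1})"
  have R: "z ^ l = 1" "z * z = 1" if "z \<in> R" for z
    using that by (auto simp: R_def split: if_splits)
  have Ul: "z ^ l = 1" if "z \<in> U" for z
    using that by (simp add: U_def)
  \<comment> \<open>Inversion sends the upper half plane to the lower one. For \<open>z = z'\<close>
    this yields irreducibility of the plane; in general it excludes the second alternative in
    \<open>rep_iso_dihedral_plane\<close>.\<close>
  have UU: "z * z' \<noteq> 1" if "z \<in> U" "z' \<in> U" for z z'
  proof
    assume "z * z' = 1"
    then have "z' = inverse z"
      by (metis inverse_unique)
    moreover have "Im (inverse z) \<le> 0"
      using that(1) by (simp add: U_def divide_nonpos_nonneg)
    ultimately show False
      using that(2) by (simp add: U_def)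
  qed
  have finU: "finite U"
    by (rule finite_subset[OF _ finite_roots_unity[of l, where 'a = complex]]) (use l in \<open>auto simp: U_def\<close>)
  have noniso_X: "z = z'" if "z \<in> U" "z' \<in> U"
    "rep_iso (dihedral_group l) (2, dihedral_plane z) (2, dihedral_plane z')" for z z'
    using rep_iso_dihedral_plane[OF l Ul Ul] UU that by blast
  have noniso_Y: "z = z' \<and> d = d'" if "z \<in> R" "z' \<in> R"
    "rep_iso (dihedral_group l) (1, dihedral_char z d) (1, dihedral_char z' d')" for z z' d d'
    using rep_iso_dihedral_char[OF l] R(1) that by blast
  have "sum fst X = 2 * card U"
  proof -
    have "inj_on (\<lambda>z. (2 :: nat, dihedral_plane z)) U"
    proof (rule inj_onI)
      fix z z' assume "(2 :: nat, dihedral_plane z) = (2, dihedral_plane z')"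
      \<comment> \<open>The equation is one of functions on all pairs, so evaluating at
        \<open>(1, False)\<close> is legitimate even if \<open>l = 1\<close>.\<close>
      then have "dihedral_plane z (1, False) $$ (0, 0) = dihedral_plane z' (1, False) $$ (0, 0)"
        by simp
      then show "z = z'"
        by (simp add: dihedral_plane_def)
    qed
    then show ?thesis
      by (simp add: X_def sum.reindex)
  qed
  moreover have "sum fst Y = 2 * card R"
  proof -
    have "inj_on (\<lambda>(z, d). (1 :: nat, dihedral_char z d)) (R \<times> {1, - 1})"
    proof (rule inj_onI, clarify)
      fix z d z' d' assume "dihedral_char z d = dihedral_char z' d'"
      then have "dihedral_char z d (i, b) $$ (0, 0) = dihedral_char z' d' (i, b) $$ (0, 0)" for i b
        by simp
      from this[of 1 False] this[of 0 True] show "z = z' \<and> d = d'"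
        by (simp add: dihedral_char_def)
    qed
    then have "sum fst Y = (\<Sum>x\<in>R \<times> {1, - 1 :: complex}. 1)"
      unfolding Y_def by (subst sum.reindex) (simp_all add: split_beta)
    also have "\<dots> = 2 * card R"
      by (simp add: card_cartesian_product)
    finally show ?thesis .
  qed
  moreover have "card R = gcd 2 l"
    by (simp add: R_def gcd_2_nat)
  moreover have "sum fst (X \<union> Y) = sum fst X + sum fst Y"
    using finU by (intro sum.union_disjoint) (auto simp: X_def Y_def R_def)
  ultimately have "l + gcd 2 l = sum fst (X \<union> Y)"
    using card_roots_unity_upper_half[OF l] by (simp add: U_def)
  also have "\<dots> \<le> sum_irreducible_degrees (dihedral_group l)"
  proof (rule sum_irreducible_degrees_ge[OF finite_irreducible_classes_dihedral[OF l]])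
    fix \<rho> assume "\<rho> \<in> X \<union> Y"
    then show "irreducible_rep (dihedral_group l) \<rho>"
      using irreducible_dihedral_plane[OF l Ul UU] irreducible_dihedral_char[OF l R]
      by (auto simp: X_def Y_def)
  next
    fix \<rho> \<sigma> assume "\<rho> \<in> X \<union> Y" "\<sigma> \<in> X \<union> Y" and iso: "rep_iso (dihedral_group l) \<rho> \<sigma>"
    \<comment> \<open>Isomorphic representations have equal degree, so no plane is isomorphic to a
      character.\<close>
    moreover have "fst \<rho> = fst \<sigma>"
      using iso by (auto simp: rep_iso_def split: prod.splits)
    moreover have "fst \<tau> = 2" if "\<tau> \<in> X" for \<tau>
      using that by (auto simp: X_def)
    moreover have "fst \<tau> \<noteq> 2" if "\<tau> \<in> Y" for \<tau>
      using that by (auto simp: Y_def)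
    ultimately consider "\<rho> \<in> X" "\<sigma> \<in> X" | "\<rho> \<in> Y" "\<sigma> \<in> Y"
      by (metis UnE)
    then show "\<rho> = \<sigma>"
    proof cases
      case 1
      then obtain z z' where "z \<in> U" "z' \<in> U" "\<rho> = (2, dihedral_plane z)" "\<sigma> = (2, dihedral_plane z')"
        by (auto simp: X_def)
      then show ?thesis
        using noniso_X iso by blast
    next
      case 2
      then obtain z d z' d' where "z \<in> R" "z' \<in> R" "\<rho> = (1, dihedral_char z d)" "\<sigma> = (1, dihedral_char z' d')"
        by (auto simp: Y_def)
      then show ?thesis
        using noniso_Y iso by blast
    qed
  qed
  finally show ?thesis .
qed

theorem corollary2p4:
  fixes l :: nat and \<alpha> :: "int \<times> bool \<Rightarrow> int \<times> bool"
  assumes "l > 0"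
    and "\<alpha> \<in> carrier (AutoGroup (dihedral_group l))"
  shows "sum_irreducible_degrees (dihedral_group l) \<ge>
           card {g \<in> carrier (dihedral_group l). \<alpha> g = inv\<^bsub>dihedral_group l\<^esub> g}"
proof -
  have "\<alpha> \<in> auto (dihedral_group l)"
    using assms(2) unfolding AutoGroup_def by simp
  then show ?thesis
    by (rule order_trans[OF card_dihedral_inverted_le[OF assms(1)] sum_irreducible_degrees_dihedral_ge[OF assms(1)]])
qed

end
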